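(* Let $N\geq2$, let $\Omega\subset\mathbb{R}^N$ be a radial open set, and let $k:(0,\infty)\to(0,\infty)$ be strictly decreasing, satisfying (k) and (k2) below with some $s\in(0,1)$. Let $f:[0,\infty)\times\mathbb{R}\to\mathbb{R}$ satisfy (F1) and (F2) below, and suppose there are $a_1,a_2$ and $q\in[2,\frac{2N}{N-2s}]$ with $|f(r,u)|\leq a_1|u|+a_2|u|^{q-1}$ for all $r\geq0$, $u\in\mathbb{R}$. Let $F(r,u)=\int_0^uf(r,\tau)d\tau$ and $K:\mathcal{D}^J(\Omega)\to\mathbb{R}$, $K[u]=\frac12\mathcal{J}(u,u)-\int_\Omega F(|x|,u(x))\,dx$. Let either (1) $u\in\mathcal{D}^J(\Omega)$ be a continuous bounded global minimizer of $K$, or (2) $u\in\mathcal{D}^J(\Omega)$ be a continuous bounded minimizer of $K$ subject to $\|u\|^q_{L^q(\Omega)}=1$. If in addition $\lim_{|x|\to\infty}u(x)=0$, then $u$ is foliated Schwarz symmetric in $\Omega$ (with respect to some $p\in S^{N-1}$).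
   Context: (k): there is $r_0>0$ such that $k$ is strictly decreasing on $(0,r_0)$, $\int_0^\infty\min\{1,r^2\}k(r)r^{N-1}dr<\infty$ and $\int_0^\infty k(r)r^{N-1}dr=\infty$. (k2): there are $c_1,r_0>0$ with $k(r)\geq c_1r^{-N-2s}$ for $r\in(0,r_0]$. $\mathcal{J}(v,w)=\int_{\mathbb{R}^N}\int_{\mathbb{R}^N}(v(x)-v(y))(w(x)-w(y))k(|x-y|)\,dxdy$, $\mathcal{D}^J(\Omega)=\{u\in L^2(\mathbb{R}^N):\mathcal{J}(u,u)<\infty,\ u\equiv0\text{ on }\mathbb{R}^N\setminus\Omega\}$. A set is radial if invariant under all rotations about the origin; $S^{N-1}$ is the unit sphere. (F1): for every $K>0$ there is $L=L(K)>0$ with $\sup_{r\geq0}|f(r,u)-f(r,v)|\leq L|u-v|$ for all $u,v\in[-K,K]$. (F2): $f(r,0)=0$ for all $r\geq0$, and there is $\delta>0$ with $\sup_{r\geq0}\frac{f(r,u)}{u}\leq0$ for all $u\in[-\delta,\delta]\setminus\{0\}$. For a radial set $D$ and $p\in S^{N-1}$, $u:D\to\mathbb{R}$ is foliated Schwarz symmetric with respect to $p$ in $D$ if for every $r>0$ with $rS^{N-1}\subset D$ and every $c\in\mathbb{R}$, the set $\{x\in rS^{N-1}:u(x)\geq c\}$ is either all of $rS^{N-1}$ or a geodesic ball in $rS^{N-1}$ centered at $rp$. *)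

theory Defs
  imports "HOL-Analysis.Analysis"
begin

definition rotation :: "(real^'n \<Rightarrow> real^'n) \<Rightarrow> bool" where
  "rotation g \<longleftrightarrow> orthogonal_transformation g \<and> det (matrix g) = 1"

definition radial_set :: "(real^'n) set \<Rightarrow> bool" where
  "radial_set D \<longleftrightarrow> (\<forall>g. rotation g \<longrightarrow> g ` D = D)"

definition Jform :: "(real \<Rightarrow> real) \<Rightarrow> (real^'n \<Rightarrow> real) \<Rightarrow> (real^'n \<Rightarrow> real) \<Rightarrow> real" where
  "Jform k v w = (LINT z|(lborel :: ((real^'n) \<times> (real^'n)) measure).
       (v (fst z) - v (snd z)) * (w (fst z) - w (snd z)) * k (dist (fst z) (snd z)))"

definition Jnn :: "(real \<Rightarrow> real) \<Rightarrow> (real^'n \<Rightarrow> real) \<Rightarrow> ennreal" where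
  "Jnn k u = (\<integral>\<^sup>+ z. ennreal ((u (fst z) - u (snd z))^2 * k (dist (fst z) (snd z)))
       \<partial>(lborel :: ((real^'n) \<times> (real^'n)) measure))"

definition DJ :: "(real \<Rightarrow> real) \<Rightarrow> (real^'n) set \<Rightarrow> (real^'n \<Rightarrow> real) set" where
  "DJ k \<Omega> = {u. u \<in> borel_measurable lborel \<and> integrable lborel (\<lambda>x. (u x)^2)
       \<and> Jnn k u < \<infinity> \<and> (\<forall>x. x \<notin> \<Omega> \<longrightarrow> u x = 0)}"

definition Fprim :: "(real \<Rightarrow> real \<Rightarrow> real) \<Rightarrow> real \<Rightarrow> real \<Rightarrow> real" where
  "Fprim f r u = (LBINT \<tau>=0..u. f r \<tau>)"

definition Kfun :: "(real \<Rightarrow> real) \<Rightarrow> (real \<Rightarrow> real \<Rightarrow> real) \<Rightarrow> (real^'n) set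
      \<Rightarrow> (real^'n \<Rightarrow> real) \<Rightarrow> real" where
  "Kfun k f \<Omega> u = Jform k u u / 2 - (LINT x:\<Omega>|lborel. Fprim f (norm x) (u x))"

definition Lq_pow :: "real \<Rightarrow> (real^'n) set \<Rightarrow> (real^'n \<Rightarrow> real) \<Rightarrow> real" where
  "Lq_pow q \<Omega> u = (LINT x:\<Omega>|lborel. \<bar>u x\<bar> powr q)"

definition geo_dist :: "real \<Rightarrow> real^'n \<Rightarrow> real^'n \<Rightarrow> real" where
  "geo_dist r x y = r * arccos ((x \<bullet> y) / r^2)"

definition geodesic_ball :: "real \<Rightarrow> real^'n \<Rightarrow> (real^'n) set \<Rightarrow> bool" where
  "geodesic_ball r c B \<longleftrightarrow> (\<exists>\<rho>\<ge>0.
       B = {x \<in> sphere 0 r. geo_dist r x c < \<rho>} \<or> B = {x \<in> sphere 0 r. geo_dist r x c \<le> \<rho>})"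

definition foliated_schwarz_sym :: "(real^'n) set \<Rightarrow> real^'n \<Rightarrow> (real^'n \<Rightarrow> real) \<Rightarrow> bool" where
  "foliated_schwarz_sym D p u \<longleftrightarrow>
     (\<forall>r>0. sphere 0 r \<subseteq> D \<longrightarrow> (\<forall>c::real.
        let S = {x \<in> sphere 0 r. u x \<ge> c} in S = sphere 0 r \<or> geodesic_ball r (r *\<^sub>R p) S))"

end

theory Submission
  imports Defs
begin

text \<open>For a hyperplane through the origin with normal e, the polarization of u puts the larger of the
  values at x and at its mirror image on the side of e. This rearranges values within spheres, so it
  preserves the integral of F and the constraint, while it does not increase J; since k is strictly
  decreasing, it decreases J strictly unless u is ordered by the reflection, one way or the other. So
  the minimizer u is ordered by every reflection. Let m be the integral of w(x) x, where
  w(x) = u(x)|u(x)|/(1+|x|). If m has positive inner product with e, the order must favour the side of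
  e; if the inner product is zero, u is symmetric under the reflection. Reflections that swap two
  points of a sphere then show that u is a nondecreasing function of the component along m on each
  sphere.\<close>

section \<open>Reflections and polarization\<close>

text \<open>The normal is not normalized, so that \<open>x - y\<close> can serve as one directly;
  for \<open>e = 0\<close> the map is the identity.\<close>

definition reflect :: "'a::real_inner \<Rightarrow> 'a \<Rightarrow> 'a" where
  "reflect e x = x - (2 * (x \<bullet> e) / (e \<bullet> e)) *\<^sub>R e"

definition polarization :: "'a::real_inner \<Rightarrow> ('a \<Rightarrow> real) \<Rightarrow> 'a \<Rightarrow> real" where
  "polarization e u x =
     (if 0 \<le> x \<bullet> e then max (u x) (u (reflect e x)) else min (u x) (u (reflect e x)))"

lemma linear_reflect: "linear (reflect e)"
  by (rule linearI) (simp_all add: reflect_def inner_add_left add_divide_distrib algebra_simps)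

lemma inner_reflect_left: "reflect e x \<bullet> e = - (x \<bullet> e)"
  by (cases "e = 0") (simp_all add: reflect_def inner_diff_left)

lemma reflect_reflect [simp]: "reflect e (reflect e x) = x"
  by (simp add: reflect_def[of e "reflect e x"] inner_reflect_left) (simp add: reflect_def)

lemma inner_reflect_reflect: "reflect e x \<bullet> reflect e y = x \<bullet> y"
  by (cases "e = 0") (simp_all add: reflect_def inner_diff_left inner_diff_right inner_commute)

lemma norm_reflect [simp]: "norm (reflect e x) = norm x"
  by (simp add: norm_eq_sqrt_inner inner_reflect_reflect)

lemma reflect_eq_self: "x \<bullet> e = 0 \<Longrightarrow> reflect e x = x"
  by (simp add: reflect_def)

lemma orthogonal_transformation_reflect: "orthogonal_transformation (reflect e)"
  by (simp add: orthogonal_transformation linear_reflect)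

lemma continuous_on_reflect [continuous_intros]:
  "continuous_on S f \<Longrightarrow> continuous_on S (\<lambda>x. reflect e (f x))"
  unfolding reflect_def divide_inverse by (intro continuous_intros)

lemma reflect_measurable [measurable]: "reflect (e::'a::euclidean_space) \<in> borel_measurable borel"
  by (intro borel_measurable_continuous_onI continuous_intros)

lemma dist_reflect_reflect: "dist (reflect e x) (reflect e y) = dist x y"
  by (metis dist_norm linear_diff linear_reflect norm_reflect)

lemma dist_reflect_right: "dist x (reflect e y) = dist (reflect e x) y"
  using dist_reflect_reflect[of e x "reflect e y"] by simp

text \<open>The sign of \<open>(x \<bullet> e) * (y \<bullet> e)\<close> decides whether
  \<open>y\<close> or its mirror image is nearer to \<open>x\<close>; this is how the hyperplane
  enters the comparison of kernel values.\<close>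

lemma dist_reflect_square:
  assumes "e \<noteq> 0"
  shows "(dist x (reflect e y))\<^sup>2 - (dist x y)\<^sup>2 = 4 * (x \<bullet> e) * (y \<bullet> e) / (e \<bullet> e)"
proof -
  have "(dist x (reflect e y))\<^sup>2 - (dist x y)\<^sup>2 = 2 * (x \<bullet> y) - 2 * (x \<bullet> reflect e y)"
    by (simp add: dist_norm power2_norm_eq_inner inner_diff_left inner_diff_right inner_reflect_reflect
        inner_commute)
  also have "\<dots> = 4 * (x \<bullet> e) * (y \<bullet> e) / (e \<bullet> e)"
    by (simp add: reflect_def inner_diff_right)
  finally show ?thesis .
qed

text \<open>For distinct points of equal norm,
  \<open>(x - y) \<bullet> (x - y) = 2 * (x \<bullet> (x - y))\<close>, so the coefficient of the
  normal in the reflection is 1.\<close>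

lemma reflect_swap:
  assumes "norm x = norm y"
  shows "reflect (x - y) x = y"
proof (cases "x = y")
  case False
  have eq: "x \<bullet> x = y \<bullet> y"
    using assms by (simp add: norm_eq)
  then have "(x - y) \<bullet> (x - y) = 2 * (x \<bullet> (x - y))"
    by (simp add: inner_diff_left inner_diff_right inner_commute)
  moreover have "(x - y) \<bullet> (x - y) \<noteq> 0"
    using False by simp
  ultimately show ?thesis
    by (simp add: reflect_def)
qed (simp add: reflect_def)

section \<open>Invariance of Lebesgue measure\<close>

text \<open>Uniqueness of Haar measure: evaluate the double integral of 1_B(x) 1_A(T y + x), with B the unit
  ball, in both orders. The library states invariance under linear isometries only for well-ordered
  index types.\<close>
lemma distr_lborel_orthogonal:
  fixes T :: "'a::euclidean_space \<Rightarrow> 'a"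
  assumes T: "orthogonal_transformation T"
  shows "distr lborel lborel T = lborel"
proof (rule measure_eqI)
  have lin: "linear T" using T by (rule orthogonal_transformation_linear)
  have [measurable]: "T \<in> borel_measurable borel"
    by (intro borel_measurable_continuous_onI linear_continuous_on)
      (use lin linear_conv_bounded_linear in blast)
  obtain S where S: "orthogonal_transformation S" "\<And>x. S (T x) = x" "\<And>x. T (S x) = x"
    using T by (metis orthogonal_transformation_bij orthogonal_transformation_inv bij_inv_eq_iff)
  fix A :: "'a set"
  assume "A \<in> sets (distr lborel lborel T)"
  then have [measurable]: "A \<in> sets borel" by simp
  let ?B = "ball (0::'a) 1"
  have [measurable]: "?B \<in> sets borel" by simp
  have translate: "(\<integral>\<^sup>+ x. g (c + x) \<partial>lborel) = (\<integral>\<^sup>+ x. g x \<partial>lborel)"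
    if "g \<in> borel_measurable borel" for g :: "'a \<Rightarrow> ennreal" and c
    using that nn_integral_distr[of "(+) c" lborel borel g] by (simp add: lborel_distr_plus)
  \<comment> \<open>Moving \<open>x\<close> inside \<open>T\<close> makes it a translation of
    \<open>y\<close>, so this inner integral does not depend on \<open>x\<close>.\<close>
  have inner1: "(\<integral>\<^sup>+ y. indicator A (T y + x) \<partial>lborel) = emeasure (distr lborel lborel T) A" for x
  proof -
    have eq: "T y + x = T (S x + y)" for y
      using S linear_add[OF lin] by (simp add: add.commute)
    have "(\<integral>\<^sup>+ y. indicator A (T (S x + y)) \<partial>lborel) = (\<integral>\<^sup>+ y. indicator A (T y) \<partial>lborel)"
      by (rule translate[of "\<lambda>y. indicator A (T y)"]) measurable
    also have "\<dots> = (\<integral>\<^sup>+ y. indicator A y \<partial>distr lborel lborel T)"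
      by (rule nn_integral_distr[symmetric]) simp_all
    finally show ?thesis by (simp add: eq)
  qed
  have inner2: "(\<integral>\<^sup>+ x. indicator ?B x * indicator A (T y + x) \<partial>lborel)
      = (\<integral>\<^sup>+ x. indicator ?B (x - T y) * indicator A x \<partial>lborel)" for y
  proof -
    have "(\<lambda>x. indicator ?B (x - T y) * indicator A x :: ennreal) \<in> borel_measurable borel"
      by measurable
    from translate[OF this, of "T y"] show ?thesis by (simp add: add.commute)
  qed
  \<comment> \<open>The points \<open>y\<close> with \<open>x - T y\<close> in the unit ball form
    the unit ball about \<open>S x\<close>.\<close>
  have inner3: "(\<integral>\<^sup>+ y. indicator ?B (x - T y) \<partial>lborel) = emeasure lborel ?B" for x
  proof -
    have "T y - x = T (y - S x)" for y
      using S linear_diff[OF lin] by simp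
    then have "norm (T y - x) = norm (S x - y)" for y
      using orthogonal_transformation_norm[OF T] norm_minus_commute by metis
    then have "indicator ?B (x - T y) = (indicator (ball (S x) 1) y :: ennreal)" for y
      by (simp add: indicator_def dist_norm)
    then have "(\<integral>\<^sup>+ y. indicator ?B (x - T y) \<partial>lborel) = emeasure lborel (ball (S x) 1)"
      by simp
    then show ?thesis by (simp add: emeasure_ball)
  qed
  have "emeasure lborel ?B * emeasure (distr lborel lborel T) A
      = (\<integral>\<^sup>+ x. \<integral>\<^sup>+ y. indicator ?B x * indicator A (T y + x) \<partial>lborel \<partial>lborel)"
    by (simp add: nn_integral_cmult inner1 nn_integral_multc mult.commute)
  also have "\<dots> = (\<integral>\<^sup>+ y. \<integral>\<^sup>+ x. indicator ?B x * indicator A (T y + x) \<partial>lborel \<partial>lborel)"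
    by (rule lborel_pair.Fubini'[symmetric]) measurable
  also have "\<dots> = (\<integral>\<^sup>+ y. \<integral>\<^sup>+ x. indicator ?B (x - T y) * indicator A x \<partial>lborel \<partial>lborel)"
    by (simp add: inner2)
  also have "\<dots> = (\<integral>\<^sup>+ x. \<integral>\<^sup>+ y. indicator ?B (x - T y) * indicator A x \<partial>lborel \<partial>lborel)"
    by (rule lborel_pair.Fubini') measurable
  also have "\<dots> = emeasure lborel ?B * emeasure lborel A"
    by (simp add: nn_integral_multc inner3 nn_integral_cmult)
  finally have "emeasure lborel ?B * emeasure (distr lborel lborel T) A
      = emeasure lborel ?B * emeasure lborel A" .
  moreover have "emeasure lborel ?B \<noteq> 0" "emeasure lborel ?B \<noteq> \<infinity>"
    using content_ball_pos[of 1 "0::'a"] emeasure_lborel_ball_finite[of "0::'a" 1]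
    by (auto simp: measure_def)
  ultimately show "emeasure (distr lborel lborel T) A = emeasure lborel A"
    by (simp add: ennreal_mult_cancel_left)
qed simp

lemma distr_lborel_reflect: "distr lborel lborel (reflect (e::'a::euclidean_space)) = lborel"
  by (rule distr_lborel_orthogonal[OF orthogonal_transformation_reflect])

text \<open>Reflecting one component of a pair is itself an orthogonal map of the product
  space.\<close>

lemma distr_lborel_reflect_fst:
  "distr lborel lborel (\<lambda>z. (reflect (e::'a::euclidean_space) (fst z), snd z :: 'a)) = lborel"
  by (rule distr_lborel_orthogonal)
    (simp add: orthogonal_transformation_def inner_prod_def inner_reflect_reflect linear_iff
      linear_add[OF linear_reflect] linear_scale[OF linear_reflect])

lemma distr_lborel_reflect_snd:
  "distr lborel lborel (\<lambda>z. (fst z :: 'a, reflect (e::'a::euclidean_space) (snd z))) = lborel"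
  by (rule distr_lborel_orthogonal)
    (simp add: orthogonal_transformation_def inner_prod_def inner_reflect_reflect linear_iff
      linear_add[OF linear_reflect] linear_scale[OF linear_reflect])

text \<open>A nonempty open set is not negligible; this carries strictness or nonvanishing on an
  open set over to integrals.\<close>

lemma not_AE_lborel_open:
  fixes U :: "'a::euclidean_space set"
  assumes "open U" "U \<noteq> {}" "\<And>x. x \<in> U \<Longrightarrow> \<not> P x"
  shows "\<not> (AE x in lborel. P x)"
proof
  assume "AE x in lborel. P x"
  then have "AE x in lborel. x \<notin> U"
    by eventually_elim (use assms(3) in blast)
  then have "U \<in> null_sets lborel"
    using assms(1) by (subst (asm) AE_iff_null_sets[symmetric]) auto
  then have "negligible U"
    by (simp add: negligible_iff_null_sets null_sets_completionI)
  with assms show False using open_not_negligible by blast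
qed

lemma nn_integral_lborel_map:
  fixes T :: "'a::euclidean_space \<Rightarrow> 'a"
  assumes "T \<in> borel_measurable borel" "distr lborel lborel T = lborel"
    and "g \<in> borel_measurable borel"
  shows "(\<integral>\<^sup>+ x. g (T x) \<partial>lborel) = (\<integral>\<^sup>+ x. g x \<partial>lborel)"
  using assms nn_integral_distr[of T lborel lborel g] by simp

text \<open>If g is not integrable, both integrals have the junk value 0.\<close>
lemma integral_swap_involution:
  fixes T :: "'a::euclidean_space \<Rightarrow> 'a" and g :: "'a \<Rightarrow> real"
  assumes [measurable]: "T \<in> borel_measurable borel" and T: "distr lborel lborel T = lborel"
    and inv: "\<And>x. T (T x) = x" and A [measurable]: "A \<in> sets borel"
    and AT: "\<And>x. T x \<in> A \<longleftrightarrow> x \<in> A"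
  shows "integral\<^sup>L lborel (\<lambda>x. if x \<in> A then g x else g (T x)) = integral\<^sup>L lborel g"
proof -
  have *: "integrable lborel (\<lambda>x. if x \<in> A then g x else g (T x)) \<and>
      integral\<^sup>L lborel (\<lambda>x. if x \<in> A then g x else g (T x)) = integral\<^sup>L lborel g"
    if g: "integrable lborel g" for g :: "'a \<Rightarrow> real"
  proof -
    have [measurable]: "g \<in> borel_measurable borel" using g by auto
    have 1: "integrable lborel (\<lambda>x. indicator A x * g x)"
      by (rule integrable_mult_indicator[OF _ g, simplified]) auto
    have 2: "integrable lborel (\<lambda>x. indicator (- A) x * g x)"
      by (rule integrable_mult_indicator[OF _ g, simplified]) auto
    \<comment> \<open>Invariance of \<open>A\<close> lets \<open>T\<close> act on the indicator as
      well, so a change of variables applies to the part off \<open>A\<close>.\<close>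
    have eq: "indicator (- A) x * g (T x) = (indicator (- A) (T x) * g (T x) :: real)" for x
      by (simp add: AT indicator_def)
    have 3: "integrable lborel (\<lambda>x. indicator (- A) x * g (T x))"
      unfolding eq using 2 integrable_distr_eq[of T lborel lborel "\<lambda>x. indicator (- A) x * g x"] T
      by simp
    have 4: "integral\<^sup>L lborel (\<lambda>x. indicator (- A) x * g (T x))
        = integral\<^sup>L lborel (\<lambda>x. indicator (- A) x * g x)"
      unfolding eq using integral_distr[of T lborel lborel "\<lambda>x. indicator (- A) x * g x"] T
      by simp
    have h: "(\<lambda>x. if x \<in> A then g x else g (T x))
        = (\<lambda>x. indicator A x * g x + indicator (- A) x * g (T x))"
      by (auto simp: indicator_def)
    have g': "g = (\<lambda>x. indicator A x * g x + indicator (- A) x * g x)"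
      by (auto simp: indicator_def)
    have "integral\<^sup>L lborel g
        = integral\<^sup>L lborel (\<lambda>x. indicator A x * g x)
          + integral\<^sup>L lborel (\<lambda>x. indicator (- A) x * g x)"
      by (subst g') (rule Bochner_Integration.integral_add[OF 1 2])
    then show ?thesis unfolding h using 1 3 4 by simp
  qed
  show ?thesis
  proof (cases "integrable lborel g")
    case False
    let ?h = "\<lambda>x. if x \<in> A then g x else g (T x)"
    \<comment> \<open>Swapping twice gives back \<open>g\<close>, so integrability of
      \<open>?h\<close> would imply that of \<open>g\<close>.\<close>
    have "(\<lambda>x. if x \<in> A then ?h x else ?h (T x)) = g"
      using AT inv by auto
    then have "\<not> integrable lborel ?h"
      using *[of ?h] False by metis
    with False show ?thesis by (simp add: not_integrable_integral_eq)
  qed (use * in blast)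
qed

section \<open>The quadratic form under polarization\<close>

text \<open>The hyperplane is covered here and in \<open>polarization_lower\<close>: a point on it
  is its own mirror image, so max and min agree. Later case splits can thus use weak
  inequalities.\<close>

lemma polarization_upper:
  "0 \<le> x \<bullet> e \<Longrightarrow> polarization e u x = max (u x) (u (reflect e x))"
  "0 \<le> x \<bullet> e \<Longrightarrow> polarization e u (reflect e x) = min (u x) (u (reflect e x))"
  by (auto simp: polarization_def inner_reflect_left reflect_eq_self min.commute)

lemma polarization_lower:
  "x \<bullet> e \<le> 0 \<Longrightarrow> polarization e u x = min (u x) (u (reflect e x))"
  "x \<bullet> e \<le> 0 \<Longrightarrow> polarization e u (reflect e x) = max (u x) (u (reflect e x))"
  by (auto simp: polarization_def inner_reflect_left reflect_eq_self max.commute)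

text \<open>Together with \<open>polarization_fixed_reflect\<close>, this exhibits polarization as a
  swap of the kind treated in \<open>integral_swap_involution\<close>, with \<open>A\<close> the set
  of unchanged points.\<close>

lemma polarization_cases:
  "polarization e u x = (if polarization e u x = u x then u x else u (reflect e x))"
  by (auto simp: polarization_def)

lemma polarization_fixed_reflect:
  "polarization e u (reflect e x) = u (reflect e x) \<longleftrightarrow> polarization e u x = u x"
  by (cases "0 \<le> x \<bullet> e") (auto simp: polarization_upper polarization_lower max_def min_def)

lemma polarization_measurable [measurable]:
  fixes u :: "'a::euclidean_space \<Rightarrow> real"
  assumes [measurable]: "u \<in> borel_measurable borel"
  shows "polarization e u \<in> borel_measurable borel"
  unfolding polarization_def by measurable

text \<open>Here \<open>c\<close> and \<open>d\<close> are the kernel values at the smaller and the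
  larger distance. If the two pairs are ordered alike, both sides agree; otherwise they differ by
  \<open>2 * (c - d) * (a' - a) * (b - b')\<close>, which is nonnegative.\<close>

lemma four_point_le:
  fixes a a' b b' c d :: real
  assumes "d \<le> c"
  shows "c * ((max a a' - max b b')\<^sup>2 + (min a a' - min b b')\<^sup>2)
       + d * ((min a a' - max b b')\<^sup>2 + (max a a' - min b b')\<^sup>2)
     \<le> c * ((a - b)\<^sup>2 + (a' - b')\<^sup>2) + d * ((a' - b)\<^sup>2 + (a - b')\<^sup>2)"
proof -
  have *: "c * ((a' - b)\<^sup>2 + (a - b')\<^sup>2) + d * ((a - b)\<^sup>2 + (a' - b')\<^sup>2)
     \<le> c * ((a - b)\<^sup>2 + (a' - b')\<^sup>2) + d * ((a' - b)\<^sup>2 + (a - b')\<^sup>2)"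
    if "0 \<le> (a' - a) * (b - b')"
  proof -
    have "0 \<le> 2 * ((c - d) * ((a' - a) * (b - b')))"
      using that assms by simp
    then show ?thesis by (simp add: power2_eq_square algebra_simps)
  qed
  consider "a \<le> a'" "b \<le> b'" | "a' \<le> a" "b' \<le> b" | "a \<le> a'" "b' \<le> b" | "a' \<le> a" "b \<le> b'"
    by linarith
  then show ?thesis
  proof cases
    case 3
    then show ?thesis using * by (simp add: add.commute)
  next
    case 4
    then show ?thesis using * by (simp add: mult_nonpos_nonpos add.commute)
  qed (simp_all add: add.commute)
qed

lemma four_point_less:
  fixes a a' b b' c d :: real
  assumes "d < c" "a' < a" "b < b'"
  shows "c * ((max a a' - max b b')\<^sup>2 + (min a a' - min b b')\<^sup>2)
       + d * ((min a a' - max b b')\<^sup>2 + (max a a' - min b b')\<^sup>2)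
     < c * ((a - b)\<^sup>2 + (a' - b')\<^sup>2) + d * ((a' - b)\<^sup>2 + (a - b')\<^sup>2)"
proof -
  have "0 < 2 * ((c - d) * ((a - a') * (b' - b)))"
    using assms by simp
  then show ?thesis using assms by (simp add: power2_eq_square algebra_simps)
qed

definition J_integrand :: "(real \<Rightarrow> real) \<Rightarrow> ('a::euclidean_space \<Rightarrow> real) \<Rightarrow> 'a \<times> 'a \<Rightarrow> real" where
  "J_integrand k u z = (u (fst z) - u (snd z))\<^sup>2 * k (dist (fst z) (snd z))"

text \<open>Summing over the four reflections of a pair of points turns the comparison of the integrals into
  a pointwise one, between two matchings of the same four values.\<close>
definition J_symmetrized ::
    "'a \<Rightarrow> (real \<Rightarrow> real) \<Rightarrow> ('a::euclidean_space \<Rightarrow> real) \<Rightarrow> 'a \<times> 'a \<Rightarrow> real" where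
  "J_symmetrized e k u z =
     J_integrand k u z + J_integrand k u (reflect e (fst z), snd z)
     + J_integrand k u (fst z, reflect e (snd z))
     + J_integrand k u (reflect e (fst z), reflect e (snd z))"

text \<open>Reflecting both points is an isometry, so only two distances occur among the four terms;
  the kernel values there are the weights in \<open>four_point_le\<close>.\<close>

lemma J_symmetrized_eq:
  "J_symmetrized e k u (x, y) =
     k (dist x y) * ((u x - u y)\<^sup>2 + (u (reflect e x) - u (reflect e y))\<^sup>2)
     + k (dist x (reflect e y)) * ((u (reflect e x) - u y)\<^sup>2 + (u x - u (reflect e y))\<^sup>2)"
  unfolding J_symmetrized_def J_integrand_def fst_conv snd_conv
    dist_reflect_reflect dist_reflect_right[symmetric]
  by (simp add: algebra_simps)

section \<open>Monotonicity of the form for a positive, strictly decreasing kernel\<close>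

locale decreasing_kernel =
  fixes k :: "real \<Rightarrow> real"
  assumes pos: "0 < r \<Longrightarrow> 0 < k r"
    and decr: "0 < r \<Longrightarrow> r < t \<Longrightarrow> k t < k r"
begin

lemma J_integrand_nonneg: "0 \<le> J_integrand k u z"
  using pos[of "dist (fst z) (snd z)"]
  by (cases "fst z = snd z") (auto simp: J_integrand_def intro!: mult_nonneg_nonneg less_imp_le)

lemma J_symmetrized_nonneg: "0 \<le> J_symmetrized e k u z"
  by (simp add: J_symmetrized_def J_integrand_nonneg)

text \<open>A monotone function is Borel on \<open>{0<..}\<close>. Replacing \<open>k\<close> by 0
  elsewhere does not change the integrand: distance 0 occurs only on the diagonal, where the squared
  difference vanishes.\<close>

lemma J_integrand_measurable [measurable]:
  assumes [measurable]: "u \<in> borel_measurable borel"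
  shows "J_integrand k u \<in> borel_measurable borel"
proof -
  have "mono_on {0<..} (\<lambda>r. - k r)"
    using decr by (auto simp: mono_on_def) (metis order_le_less)
  then have "(\<lambda>r. - k r) \<in> borel_measurable (restrict_space borel {0<..})"
    by (rule borel_measurable_mono_on_fnc)
  then have "(\<lambda>r. - (- k r)) \<in> borel_measurable (restrict_space borel {0<..})"
    by (rule borel_measurable_uminus)
  then have "k \<in> borel_measurable (restrict_space borel {0<..})"
    by simp
  then have [measurable]: "(\<lambda>r. if r \<in> {0<..} then k r else 0) \<in> borel_measurable borel"
    by (subst (asm) measurable_restrict_space_iff[of _ _ 0]) auto
  have "J_integrand k u = (\<lambda>z. (u (fst z) - u (snd z))\<^sup>2 *
      (\<lambda>r. if r \<in> {0<..} then k r else 0) (dist (fst z) (snd z)))"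
    by (auto simp: J_integrand_def fun_eq_iff)
  also have "\<dots> \<in> borel_measurable borel"
    unfolding borel_prod[symmetric] by measurable
  finally show ?thesis .
qed

lemma J_symmetrized_measurable [measurable]:
  assumes [measurable]: "u \<in> borel_measurable borel"
  shows "J_symmetrized e k u \<in> borel_measurable borel"
proof -
  have [measurable]: "J_integrand k u \<in> borel_measurable (borel \<Otimes>\<^sub>M borel)"
    unfolding borel_prod by measurable
  show ?thesis
    unfolding J_symmetrized_def[abs_def] borel_prod[symmetric] by measurable
qed

text \<open>On a common side of the hyperplane, the direct distance is the smaller one and
  polarization matches large values with large ones across it. On opposite sides, the mirror image
  of \<open>y\<close> takes the place of \<open>y\<close>.\<close>

lemma J_symmetrized_polarization_le:
  assumes "e \<noteq> 0"
  shows "J_symmetrized e k (polarization e u) (x, y) \<le> J_symmetrized e k u (x, y)"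
proof -
  let ?a = "u x" and ?a' = "u (reflect e x)" and ?b = "u y" and ?b' = "u (reflect e y)"
  have dist_le: "dist x y \<le> dist x (reflect e y)" if "0 \<le> (x \<bullet> e) * (y \<bullet> e)"
  proof (rule power2_le_imp_le)
    have "0 \<le> 4 * (x \<bullet> e) * (y \<bullet> e) / (e \<bullet> e)"
      using that by (simp add: mult.assoc)
    then show "(dist x y)\<^sup>2 \<le> (dist x (reflect e y))\<^sup>2"
      using dist_reflect_square[OF assms, of x y] by linarith
  qed simp
  have dist_ge: "dist x (reflect e y) \<le> dist x y" if "(x \<bullet> e) * (y \<bullet> e) \<le> 0"
  proof (rule power2_le_imp_le)
    have "4 * (x \<bullet> e) * (y \<bullet> e) / (e \<bullet> e) \<le> 0"
      using that by (simp add: mult.assoc divide_nonpos_nonneg)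
    then show "(dist x (reflect e y))\<^sup>2 \<le> (dist x y)\<^sup>2"
      using dist_reflect_square[OF assms, of x y] by linarith
  qed simp
  have mono: "k t \<le> k r" if "0 < r" "r \<le> t" for r t
    using decr[of r t] that by (cases "r = t") auto
  \<comment> \<open>Monotonicity of \<open>k\<close> does not reach distance 0, so the pairs where
    one of the two distances vanishes are computed directly.\<close>
  consider "x = y" | "x = reflect e y" | "x \<noteq> y" "x \<noteq> reflect e y" by blast
  then show ?thesis
  proof cases
    case 1
    then show ?thesis
      by (cases "0 \<le> x \<bullet> e")
        (auto simp: J_symmetrized_eq polarization_upper polarization_lower max_def min_def
          power2_commute)
  next
    case 2
    then have "y = reflect e x" by simp
    then show ?thesis
      by (cases "0 \<le> x \<bullet> e")
        (auto simp: J_symmetrized_eq polarization_upper polarization_lower max_def min_def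
          power2_commute)
  next
    case 3
    then have pos_dist: "0 < dist x y" "0 < dist x (reflect e y)" by auto
    consider "0 \<le> x \<bullet> e" "0 \<le> y \<bullet> e" | "x \<bullet> e \<le> 0" "y \<bullet> e \<le> 0"
      | "0 \<le> x \<bullet> e" "y \<bullet> e \<le> 0" | "x \<bullet> e \<le> 0" "0 \<le> y \<bullet> e"
      by linarith
    then show ?thesis
    proof cases
      case 1
      then have "k (dist x (reflect e y)) \<le> k (dist x y)"
        using mono dist_le pos_dist by simp
      from four_point_le[OF this, of ?a ?a' ?b ?b'] show ?thesis
        using 1 by (simp add: J_symmetrized_eq polarization_upper)
    next
      case 2
      then have "k (dist x (reflect e y)) \<le> k (dist x y)"
        using mono dist_le pos_dist by (simp add: mult_nonpos_nonpos)
      from four_point_le[OF this, of ?a' ?a ?b' ?b] show ?thesis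
        using 2 by (simp add: J_symmetrized_eq polarization_lower max.commute min.commute add.commute)
    next
      case 3
      then have "k (dist x y) \<le> k (dist x (reflect e y))"
        using mono dist_ge pos_dist by (simp add: mult_nonneg_nonpos)
      from four_point_le[OF this, of ?a ?a' ?b' ?b] show ?thesis
        using 3 by (simp add: J_symmetrized_eq polarization_upper polarization_lower
            max.commute min.commute add.commute)
    next
      case 4
      then have "k (dist x y) \<le> k (dist x (reflect e y))"
        using mono dist_ge pos_dist by (simp add: mult_nonpos_nonneg)
      from four_point_le[OF this, of ?a' ?a ?b ?b'] show ?thesis
        using 4 by (simp add: J_symmetrized_eq polarization_upper polarization_lower
            max.commute min.commute add.commute)
    qed
  qed
qed

text \<open>Oppositely ordered pairs strictly inside the same half-space are genuinely rematched,
  and there the two kernel values differ.\<close>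

lemma J_symmetrized_polarization_less:
  assumes "0 < x \<bullet> e" "0 < y \<bullet> e" "u (reflect e x) < u x" "u y < u (reflect e y)"
  shows "J_symmetrized e k (polarization e u) (x, y) < J_symmetrized e k u (x, y)"
proof -
  have e: "e \<noteq> 0" using assms(1) by auto
  have "0 < 4 * (x \<bullet> e) * (y \<bullet> e) / (e \<bullet> e)"
    using assms(1,2) e by simp
  then have "(dist x y)\<^sup>2 < (dist x (reflect e y))\<^sup>2"
    using dist_reflect_square[OF e, of x y] by linarith
  then have "dist x y < dist x (reflect e y)"
    by (rule power2_less_imp_less) simp
  moreover have "x \<noteq> y" using assms(3,4) by auto
  ultimately have "k (dist x (reflect e y)) < k (dist x y)"
    using decr by simp
  from four_point_less[OF this assms(3,4)] show ?thesis
    using assms(1,2) by (simp add: J_symmetrized_eq polarization_upper)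
qed

text \<open>Each of the four terms is the integrand composed with a measure-preserving map; working
  in \<open>ennreal\<close> allows infinite values.\<close>

lemma nn_integral_J_symmetrized:
  fixes u :: "real^'n \<Rightarrow> real"
  assumes [measurable]: "u \<in> borel_measurable borel"
  shows "(\<integral>\<^sup>+ z. ennreal (J_symmetrized e k u z) \<partial>lborel) = 4 * Jnn k u"
proof -
  let ?I = "\<lambda>z. ennreal (J_integrand k u z)"
  let ?S = "\<lambda>z::(real^'n) \<times> (real^'n). (reflect e (fst z), snd z)"
    and ?T = "\<lambda>z::(real^'n) \<times> (real^'n). (fst z, reflect e (snd z))"
  have [measurable]: "?S \<in> borel_measurable borel" "?T \<in> borel_measurable borel"
    unfolding borel_prod[symmetric] by measurable
  have S: "(\<integral>\<^sup>+ z. g (?S z) \<partial>lborel) = (\<integral>\<^sup>+ z. g z \<partial>lborel)"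
    and T: "(\<integral>\<^sup>+ z. g (?T z) \<partial>lborel) = (\<integral>\<^sup>+ z. g z \<partial>lborel)"
    if "g \<in> borel_measurable borel" for g :: "(real^'n) \<times> (real^'n) \<Rightarrow> ennreal"
    using that distr_lborel_reflect_fst distr_lborel_reflect_snd
    by (auto intro!: nn_integral_lborel_map)
  have J: "(\<integral>\<^sup>+ z. ?I z \<partial>lborel) = Jnn k u"
    by (simp add: Jnn_def J_integrand_def)
  have "(\<integral>\<^sup>+ z. ennreal (J_symmetrized e k u z) \<partial>lborel)
      = (\<integral>\<^sup>+ z. ?I z + ?I (?S z) + ?I (?T z) + ?I (?S (?T z)) \<partial>lborel)"
    by (simp add: J_symmetrized_def J_integrand_nonneg)
  also have "\<dots> = (\<integral>\<^sup>+ z. ?I z \<partial>lborel) + (\<integral>\<^sup>+ z. ?I (?S z) \<partial>lborel)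
      + (\<integral>\<^sup>+ z. ?I (?T z) \<partial>lborel) + (\<integral>\<^sup>+ z. ?I (?S (?T z)) \<partial>lborel)"
    by (simp add: nn_integral_add del: fst_conv snd_conv)
  also have "(\<integral>\<^sup>+ z. ?I (?S (?T z)) \<partial>lborel) = (\<integral>\<^sup>+ z. ?I (?S z) \<partial>lborel)"
    by (rule T[of "\<lambda>z. ?I (?S z)"]) measurable
  also have "(\<integral>\<^sup>+ z. ?I (?S z) \<partial>lborel) = (\<integral>\<^sup>+ z. ?I z \<partial>lborel)"
    by (rule S) measurable
  also have "(\<integral>\<^sup>+ z. ?I (?T z) \<partial>lborel) = (\<integral>\<^sup>+ z. ?I z \<partial>lborel)"
    by (rule T) measurable
  finally show ?thesis
    unfolding J numeral_Bit0 numeral_One distrib_right mult_1_left add.assoc .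
qed

lemma Jnn_polarization_le:
  fixes u :: "real^'n \<Rightarrow> real"
  assumes "e \<noteq> 0" and [measurable]: "u \<in> borel_measurable borel"
  shows "Jnn k (polarization e u) \<le> Jnn k u"
proof -
  have "4 * Jnn k (polarization e u) \<le> 4 * Jnn k u"
    unfolding nn_integral_J_symmetrized[where e = e, symmetric, OF assms(2)]
      nn_integral_J_symmetrized[where e = e, symmetric, OF polarization_measurable[OF assms(2)]]
    using J_symmetrized_polarization_le[OF assms(1)]
    by (intro nn_integral_mono ennreal_leI) (metis surj_pair)
  then show ?thesis by (simp add: ennreal_mult_le_mult_iff)
qed

text \<open>The pointwise comparison is strict on the nonempty open set \<open>U \<times> V\<close>,
  and finiteness makes this visible in the integrals.\<close>

lemma Jnn_polarization_less:
  fixes u :: "real^'n \<Rightarrow> real"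
  assumes [measurable]: "u \<in> borel_measurable borel" and fin: "Jnn k u < \<infinity>"
    and U: "open U" "U \<noteq> {}" "\<And>x. x \<in> U \<Longrightarrow> 0 < x \<bullet> e \<and> u (reflect e x) < u x"
    and V: "open V" "V \<noteq> {}" "\<And>x. x \<in> V \<Longrightarrow> 0 < x \<bullet> e \<and> u x < u (reflect e x)"
  shows "Jnn k (polarization e u) < Jnn k u"
proof -
  have e: "e \<noteq> 0" using U(2,3) by force
  have less: "J_symmetrized e k (polarization e u) z < J_symmetrized e k u z" if "z \<in> U \<times> V" for z
    using that U(3)[of "fst z"] V(3)[of "snd z"]
      J_symmetrized_polarization_less[of "fst z" e "snd z" u]
    by auto
  have "4 * Jnn k (polarization e u) < 4 * Jnn k u"
    unfolding nn_integral_J_symmetrized[where e = e, symmetric, OF assms(1)]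
      nn_integral_J_symmetrized[where e = e, symmetric, OF polarization_measurable[OF assms(1)]]
  proof (rule nn_integral_less)
    have "4 * Jnn k (polarization e u) < \<infinity>"
      using order.strict_trans1[OF Jnn_polarization_le[OF e assms(1)] fin]
      by (simp add: ennreal_mult_less_top)
    then show "(\<integral>\<^sup>+ z. ennreal (J_symmetrized e k (polarization e u) z) \<partial>lborel) \<noteq> \<infinity>"
      by (simp add: nn_integral_J_symmetrized)
    show "AE z in lborel. ennreal (J_symmetrized e k (polarization e u) z)
        \<le> ennreal (J_symmetrized e k u z)"
      using J_symmetrized_polarization_le[OF e] by (intro AE_I2 ennreal_leI) (metis surj_pair)
    show "\<not> (AE z in lborel. ennreal (J_symmetrized e k u z)
        \<le> ennreal (J_symmetrized e k (polarization e u) z))"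
      by (rule not_AE_lborel_open[of "U \<times> V"])
        (use U V less in \<open>auto simp: open_Times ennreal_le_iff J_symmetrized_nonneg not_le\<close>)
  qed simp_all
  moreover have "4 * Jnn k u \<le> 4 * Jnn k (polarization e u)" if "Jnn k u \<le> Jnn k (polarization e u)"
    using that by (rule mult_left_mono) simp
  ultimately show ?thesis
    by (meson leD linorder_le_less_linear)
qed

text \<open>The integrand is nonnegative. If \<open>Jnn k u\<close> is infinite, both sides take the
  default value 0, so order comparisons also need the finiteness contained in
  \<open>DJ\<close>.\<close>

lemma Jform_eq_Jnn:
  fixes u :: "real^'n \<Rightarrow> real"
  assumes [measurable]: "u \<in> borel_measurable borel"
  shows "Jform k u u = enn2real (Jnn k u)"
proof -
  have "Jform k u u = integral\<^sup>L lborel (J_integrand k u)"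
    by (simp add: Jform_def J_integrand_def[abs_def] power2_eq_square)
  also have "\<dots> = enn2real (Jnn k u)"
    by (subst integral_eq_nn_integral)
      (auto simp: J_integrand_nonneg Jnn_def J_integrand_def[symmetric])
  finally show ?thesis .
qed

end

section \<open>Polarization as a competitor in the minimization\<close>

text \<open>A reflection with nonzero normal is not a rotation, but in dimension at least 2
  rotations act transitively on spheres, so membership in a radial set depends on the norm
  alone.\<close>

lemma radial_reflect:
  fixes \<Omega> :: "(real^'n) set"
  assumes N2: "CARD('n) \<ge> 2" and rad: "radial_set \<Omega>"
  shows "reflect e x \<in> \<Omega> \<longleftrightarrow> x \<in> \<Omega>"
proof -
  have "y \<in> \<Omega>" if "x \<in> \<Omega>" "norm x = norm y" for x y
  proof -
    obtain g where "orthogonal_transformation g" "det (matrix g) = 1" "g x = y"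
      using rotation_exists[OF N2 \<open>norm x = norm y\<close>] by blast
    then show ?thesis
      using rad that(1) unfolding radial_set_def rotation_def by blast
  qed
  from this[of x "reflect e x"] this[of "reflect e x" x] show ?thesis by auto
qed

text \<open>The integrand sees the position only through its norm, which the swap preserves.
  \<open>G\<close> is arbitrary, so that this serves both the potential term and the constraint;
  non-integrable cases are covered by \<open>integral_swap_involution\<close>.\<close>

lemma integral_polarization:
  fixes u :: "'a::euclidean_space \<Rightarrow> real" and G :: "real \<Rightarrow> real \<Rightarrow> real"
  assumes [measurable]: "u \<in> borel_measurable borel" and inv: "\<And>x. reflect e x \<in> \<Omega> \<longleftrightarrow> x \<in> \<Omega>"
  shows "(LINT x:\<Omega>|lborel. G (norm x) (polarization e u x)) = (LINT x:\<Omega>|lborel. G (norm x) (u x))"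
proof -
  let ?A = "{x. polarization e u x = u x}"
  let ?g = "\<lambda>x. indicator \<Omega> x *\<^sub>R G (norm x) (u x)"
  have "indicator \<Omega> x *\<^sub>R G (norm x) (polarization e u x)
      = (if x \<in> ?A then ?g x else ?g (reflect e x))" for x
    using polarization_cases[of e u x] by (auto simp: inv indicator_def)
  then have "(LINT x:\<Omega>|lborel. G (norm x) (polarization e u x))
      = integral\<^sup>L lborel (\<lambda>x. if x \<in> ?A then ?g x else ?g (reflect e x))"
    unfolding set_lebesgue_integral_def by metis
  also have "\<dots> = integral\<^sup>L lborel ?g"
    by (rule integral_swap_involution[where g = ?g and T = "reflect e" and A = ?A])
      (simp_all add: distr_lborel_reflect polarization_fixed_reflect)
  finally show ?thesis
    unfolding set_lebesgue_integral_def .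
qed

lemma open_reflect_less:
  fixes u :: "'a::euclidean_space \<Rightarrow> real"
  assumes "open \<Omega>" "continuous_on \<Omega> u" and inv: "\<And>x. reflect e x \<in> \<Omega> \<longleftrightarrow> x \<in> \<Omega>"
  shows "open {x \<in> \<Omega>. 0 < x \<bullet> e \<and> u (reflect e x) < u x}"
    and "open {x \<in> \<Omega>. 0 < x \<bullet> e \<and> u x < u (reflect e x)}"
proof -
  have refl_cont: "continuous_on \<Omega> (\<lambda>x. u (reflect e x))"
    by (rule continuous_on_compose2[OF assms(2)]) (auto intro!: continuous_intros simp: inv)
  have "open (\<Omega> \<inter> (\<lambda>x. (x \<bullet> e, u x - u (reflect e x))) -` ({0<..} \<times> {0<..}))"
    using assms refl_cont
    by (intro continuous_open_preimage continuous_intros open_Times) auto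
  moreover have "open (\<Omega> \<inter> (\<lambda>x. (x \<bullet> e, u x - u (reflect e x))) -` ({0<..} \<times> {..<0}))"
    using assms refl_cont
    by (intro continuous_open_preimage continuous_intros open_Times) auto
  moreover have "\<Omega> \<inter> (\<lambda>x. (x \<bullet> e, u x - u (reflect e x))) -` ({0<..} \<times> {0<..})
      = {x \<in> \<Omega>. 0 < x \<bullet> e \<and> u (reflect e x) < u x}"
    "\<Omega> \<inter> (\<lambda>x. (x \<bullet> e, u x - u (reflect e x))) -` ({0<..} \<times> {..<0})
      = {x \<in> \<Omega>. 0 < x \<bullet> e \<and> u x < u (reflect e x)}"
    by auto
  ultimately show "open {x \<in> \<Omega>. 0 < x \<bullet> e \<and> u (reflect e x) < u x}"
    and "open {x \<in> \<Omega>. 0 < x \<bullet> e \<and> u x < u (reflect e x)}"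
    by simp_all
qed

text \<open>Admissibility of the competitor: its square is at most the sum of the squares of
  \<open>u\<close> and of the reflected \<open>u\<close>.\<close>

lemma (in decreasing_kernel) polarization_DJ:
  fixes u :: "real^'n \<Rightarrow> real"
  assumes e: "e \<noteq> 0" and inv: "\<And>x. reflect e x \<in> \<Omega> \<longleftrightarrow> x \<in> \<Omega>" and uD: "u \<in> DJ k \<Omega>"
  shows "polarization e u \<in> DJ k \<Omega>"
proof -
  have [measurable]: "u \<in> borel_measurable borel" and int: "integrable lborel (\<lambda>x. (u x)\<^sup>2)"
    and J: "Jnn k u < \<infinity>" and zero: "\<And>x. x \<notin> \<Omega> \<Longrightarrow> u x = 0"
    using uD by (auto simp: DJ_def)
  have "integrable lborel (\<lambda>x. (u (reflect e x))\<^sup>2)"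
    using int integrable_distr_eq[of "reflect e" lborel lborel "\<lambda>x. (u x)\<^sup>2"]
    by (simp add: distr_lborel_reflect)
  with int have "integrable lborel (\<lambda>x. (u x)\<^sup>2 + (u (reflect e x))\<^sup>2)"
    by (rule Bochner_Integration.integrable_add)
  then have "integrable lborel (\<lambda>x. (polarization e u x)\<^sup>2)"
    by (rule Bochner_Integration.integrable_bound) (auto simp: polarization_def max_def min_def)
  moreover have "Jnn k (polarization e u) < \<infinity>"
    using Jnn_polarization_le[OF e] J by (rule order.strict_trans1) measurable
  ultimately show ?thesis
    by (auto simp: DJ_def polarization_def zero inv)
qed

text \<open>If neither order holds, both strict orders occur at points of the half-space, by
  continuity on open sets, and polarization would strictly lower the form.\<close>

lemma (in decreasing_kernel) minimizer_ordered_by_reflections: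
  fixes u :: "real^'n \<Rightarrow> real"
  assumes "open \<Omega>" "continuous_on \<Omega> u" and e: "e \<noteq> 0"
    and inv: "\<And>x. reflect e x \<in> \<Omega> \<longleftrightarrow> x \<in> \<Omega>" and uD: "u \<in> DJ k \<Omega>"
    and min: "Jform k u u \<le> Jform k (polarization e u) (polarization e u)"
  shows "(\<forall>x. 0 \<le> x \<bullet> e \<longrightarrow> u (reflect e x) \<le> u x) \<or> (\<forall>x. 0 \<le> x \<bullet> e \<longrightarrow> u x \<le> u (reflect e x))"
proof (rule ccontr)
  have [measurable]: "u \<in> borel_measurable borel"
    and J: "Jnn k u < \<infinity>" and zero: "\<And>x. x \<notin> \<Omega> \<Longrightarrow> u x = 0"
    using uD by (auto simp: DJ_def)
  assume "\<not> ?thesis"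
  then obtain x y where x: "0 \<le> x \<bullet> e" "u x < u (reflect e x)"
    and y: "0 \<le> y \<bullet> e" "u (reflect e y) < u y"
    by (auto simp: not_le)
  \<comment> \<open>Off \<open>\<Omega>\<close> both values are 0, and on the hyperplane they
    coincide.\<close>
  have pos: "z \<in> \<Omega> \<and> 0 < z \<bullet> e" if "0 \<le> z \<bullet> e" "u z \<noteq> u (reflect e z)" for z
    using that zero inv reflect_eq_self[of z e] by (cases "z \<bullet> e = 0") force+
  have "Jnn k (polarization e u) < Jnn k u"
  proof (rule Jnn_polarization_less)
    show "open {x \<in> \<Omega>. 0 < x \<bullet> e \<and> u (reflect e x) < u x}"
      and "open {x \<in> \<Omega>. 0 < x \<bullet> e \<and> u x < u (reflect e x)}"
      using open_reflect_less assms by blast+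
    show "{x \<in> \<Omega>. 0 < x \<bullet> e \<and> u (reflect e x) < u x} \<noteq> {}"
      using pos[of y] y by auto
    show "{x \<in> \<Omega>. 0 < x \<bullet> e \<and> u x < u (reflect e x)} \<noteq> {}"
      using pos[of x] x by auto
  qed (use J in auto)
  then have "enn2real (Jnn k (polarization e u)) < enn2real (Jnn k u)"
    using J by (simp add: enn2real_less_iff enn2real_mono less_top)
  then show False
    using min by (simp add: Jform_eq_Jnn)
qed

section \<open>The axis of symmetry\<close>

lemma mult_abs_strict_mono: "s < t \<Longrightarrow> s * \<bar>s\<bar> < t * \<bar>t\<bar>" for s t :: real
proof -
  assume st: "s < t"
  consider "0 \<le> s" | "s < 0" "0 \<le> t" | "t < 0" using st by linarith
  then show ?thesis
  proof cases
    case 1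
    then show ?thesis using st mult_strict_mono[of s t s t] by simp
  next
    case 2
    then have "s * \<bar>s\<bar> < 0" "0 \<le> t * \<bar>t\<bar>" by (simp_all add: mult_neg_neg)
    then show ?thesis by linarith
  next
    case 3
    then show ?thesis using st mult_strict_mono[of "-t" "-s" "-t" "-s"] by simp
  qed
qed

lemma mult_abs_le_iff: "s * \<bar>s\<bar> \<le> t * \<bar>t\<bar> \<longleftrightarrow> s \<le> t" for s t :: real
  using mult_abs_strict_mono[of s t] mult_abs_strict_mono[of t s]
  by (cases s t rule: linorder_cases) auto

text \<open>The increasing function t|t| of u and the weight 1/(1+|x|) make the integrand bounded by the
  square of u, hence integrable.\<close>
definition weighted_moment :: "('a::euclidean_space \<Rightarrow> real) \<Rightarrow> 'a" where
  "weighted_moment u = (\<integral>x. (u x * \<bar>u x\<bar> / (1 + norm x)) *\<^sub>R x \<partial>lborel)"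

text \<open>The reflection preserves the weight and flips the sign of the component along
  \<open>e\<close>; \<open>h e\<close> is the sum of the integrand and its reflected copy, each
  contributing the same integral.\<close>

lemma weighted_moment_inner:
  fixes u :: "'a::euclidean_space \<Rightarrow> real"
  assumes [measurable]: "u \<in> borel_measurable borel" and int: "integrable lborel (\<lambda>x. (u x)\<^sup>2)"
  defines "h \<equiv> \<lambda>e x. (u x * \<bar>u x\<bar> - u (reflect e x) * \<bar>u (reflect e x)\<bar>) * (x \<bullet> e) / (1 + norm x)"
  shows "integrable lborel (h e)" and "integral\<^sup>L lborel (h e) = 2 * (weighted_moment u \<bullet> e)"
proof -
  let ?g = "\<lambda>x. (u x * \<bar>u x\<bar> / (1 + norm x)) *\<^sub>R x"
  have "norm (?g x) \<le> norm ((u x)\<^sup>2)" for x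
  proof -
    have "norm (?g x) = (u x)\<^sup>2 * (norm x / (1 + norm x))"
      by (simp add: abs_mult power2_eq_square abs_mult_self_eq mult.assoc)
    also have "\<dots> \<le> (u x)\<^sup>2 * 1"
      by (intro mult_left_mono) (simp_all add: divide_le_eq_1_pos add_pos_nonneg)
    finally show ?thesis by simp
  qed
  then have g: "integrable lborel ?g"
    by (intro Bochner_Integration.integrable_bound[OF int]) auto
  have ge: "integrable lborel (\<lambda>x. ?g x \<bullet> e)" "integral\<^sup>L lborel (\<lambda>x. ?g x \<bullet> e) = weighted_moment u \<bullet> e"
    unfolding weighted_moment_def
    by (rule integrable_inner_left integral_inner_left, use g in blast)+
  have gr: "integrable lborel (\<lambda>x. ?g (reflect e x) \<bullet> e)"
    "integral\<^sup>L lborel (\<lambda>x. ?g (reflect e x) \<bullet> e) = weighted_moment u \<bullet> e"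
    using ge integrable_distr_eq[of "reflect e" lborel lborel "\<lambda>x. ?g x \<bullet> e"]
      integral_distr[of "reflect e" lborel lborel "\<lambda>x. ?g x \<bullet> e"]
    unfolding distr_lborel_reflect by simp_all
  have h: "h e = (\<lambda>x. ?g x \<bullet> e + ?g (reflect e x) \<bullet> e)"
    unfolding h_def inner_scaleR_left inner_reflect_left norm_reflect
    by (simp add: diff_divide_distrib left_diff_distrib)
  show "integrable lborel (h e)" "integral\<^sup>L lborel (h e) = 2 * (weighted_moment u \<bullet> e)"
    unfolding h using ge gr by simp_all
qed

text \<open>The order makes both factors of \<open>h\<close> agree in sign on either side of the
  hyperplane. A nonnegative function with integral 0 vanishes almost everywhere, and by continuity
  everywhere on \<open>\<Omega>\<close>.\<close>

lemma weighted_moment_reflect: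
  fixes u :: "'a::euclidean_space \<Rightarrow> real"
  assumes \<Omega>: "open \<Omega>" "continuous_on \<Omega> u" and inv: "\<And>x. reflect e x \<in> \<Omega> \<longleftrightarrow> x \<in> \<Omega>"
    and zero: "\<And>x. x \<notin> \<Omega> \<Longrightarrow> u x = 0"
    and u: "u \<in> borel_measurable borel" "integrable lborel (\<lambda>x. (u x)\<^sup>2)"
    and ord: "\<And>x. 0 \<le> x \<bullet> e \<Longrightarrow> u (reflect e x) \<le> u x"
  shows "0 \<le> weighted_moment u \<bullet> e"
    and "weighted_moment u \<bullet> e = 0 \<Longrightarrow> u (reflect e x) = u x"
proof -
  define h where
    "h x = (u x * \<bar>u x\<bar> - u (reflect e x) * \<bar>u (reflect e x)\<bar>) * (x \<bullet> e) / (1 + norm x)" for x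
  have int: "integrable lborel h" "integral\<^sup>L lborel h = 2 * (weighted_moment u \<bullet> e)"
    using weighted_moment_inner[OF u, of e] by (simp_all add: h_def[abs_def])
  have nonneg: "0 \<le> h x" for x
  proof (cases "0 \<le> x \<bullet> e")
    case True
    then show ?thesis using ord[of x] by (simp add: h_def mult_abs_le_iff)
  next
    case False
    then have "u x \<le> u (reflect e x)" using ord[of "reflect e x"] by (simp add: inner_reflect_left)
    then show ?thesis using False by (simp add: h_def mult_abs_le_iff mult_nonpos_nonpos)
  qed
  then have "0 \<le> integral\<^sup>L lborel h" by (intro integral_nonneg_AE) simp
  then show "0 \<le> weighted_moment u \<bullet> e" using int by simp
  have cont: "continuous_on \<Omega> h"
    unfolding h_def
    by (intro continuous_intros \<Omega>(2) continuous_on_compose2[OF \<Omega>(2)])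
      (auto simp: inv add_nonneg_eq_0_iff)
  show "u (reflect e x) = u x" if m0: "weighted_moment u \<bullet> e = 0"
  proof (rule ccontr)
    assume neq: "u (reflect e x) \<noteq> u x"
    then have "x \<bullet> e \<noteq> 0" using reflect_eq_self[of x e] by metis
    moreover have "u x * \<bar>u x\<bar> \<noteq> u (reflect e x) * \<bar>u (reflect e x)\<bar>"
      using neq mult_abs_le_iff by (metis antisym order_refl)
    moreover have "1 + norm x \<noteq> 0" by (simp add: add_nonneg_eq_0_iff)
    ultimately have "h x \<noteq> 0" by (simp add: h_def)
    moreover have "x \<in> \<Omega>" using neq zero inv by metis
    moreover have "open (\<Omega> \<inter> h -` (- {0}))"
      by (rule continuous_open_preimage[OF cont \<Omega>(1)]) auto
    moreover have "AE x in lborel. h x = 0"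
      using integral_nonneg_eq_0_iff_AE[OF int(1)] nonneg int(2) m0 by simp
    ultimately show False
      using not_AE_lborel_open[of "\<Omega> \<inter> h -` (- {0})" "\<lambda>x. h x = 0"] by auto
  qed
qed

section \<open>Spherical caps and monotonicity along an axis\<close>

text \<open>The Cauchy-Schwarz bound keeps the argument of \<open>arccos\<close> in its proper
  range, where it is monotone and nonnegative.\<close>

lemma geo_dist_axis:
  fixes p :: "real^'n"
  assumes r: "0 < r" and p: "norm p = 1" and x: "norm x = r"
  shows "geo_dist r x (r *\<^sub>R p) = r * arccos (x \<bullet> p / r)" and "\<bar>x \<bullet> p / r\<bar> \<le> 1"
    and "0 \<le> geo_dist r x (r *\<^sub>R p)"
proof -
  show gd: "geo_dist r x (r *\<^sub>R p) = r * arccos (x \<bullet> p / r)"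
    using r by (simp add: geo_dist_def power2_eq_square)
  show bd: "\<bar>x \<bullet> p / r\<bar> \<le> 1"
    using Cauchy_Schwarz_ineq2[of x p] x r p by (simp add: divide_le_eq)
  then have "0 \<le> arccos (x \<bullet> p / r)"
    by (intro arccos_lbound) linarith+
  then show "0 \<le> geo_dist r x (r *\<^sub>R p)"
    unfolding gd using r by simp
qed

text \<open>Since \<open>arccos\<close> is decreasing, greater height along \<open>p\<close> means
  smaller geodesic distance; the radius is the distance of \<open>x1\<close> from the pole.\<close>

lemma geodesic_ball_cap:
  fixes p :: "real^'n"
  assumes r: "0 < r" and p: "norm p = 1" and x1: "norm x1 = r"
  shows "geodesic_ball r (r *\<^sub>R p) {x \<in> sphere 0 r. x1 \<bullet> p \<le> x \<bullet> p}"
proof -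
  have "geo_dist r x (r *\<^sub>R p) \<le> geo_dist r x1 (r *\<^sub>R p) \<longleftrightarrow> x1 \<bullet> p \<le> x \<bullet> p" if "norm x = r" for x
    using r arccos_le_mono[OF geo_dist_axis(2)[OF r p that] geo_dist_axis(2)[OF r p x1]]
    by (simp add: geo_dist_axis(1)[OF r p] that x1 divide_le_cancel)
  then have "{x \<in> sphere 0 r. x1 \<bullet> p \<le> x \<bullet> p}
      = {x \<in> sphere 0 r. geo_dist r x (r *\<^sub>R p) \<le> geo_dist r x1 (r *\<^sub>R p)}"
    by auto
  then show ?thesis
    unfolding geodesic_ball_def using geo_dist_axis(3)[OF r p x1] by blast
qed

text \<open>By compactness a nonempty superlevel set has a lowest point along \<open>p\<close>;
  monotonicity makes the set the whole cap above that point.\<close>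

lemma foliated_schwarz_symI:
  fixes p :: "real^'n"
  assumes cont: "continuous_on \<Omega> u" and p: "norm p = 1"
    and mono: "\<And>x y. norm x = norm y \<Longrightarrow> y \<bullet> p \<le> x \<bullet> p \<Longrightarrow> u y \<le> u x"
  shows "foliated_schwarz_sym \<Omega> p u"
  unfolding foliated_schwarz_sym_def Let_def
\<comment> \<open>The second alternative always holds: the full sphere is also a cap.\<close>
proof (intro allI impI disjI2)
  fix r c :: real
  assume r: "0 < r" and sub: "sphere 0 r \<subseteq> \<Omega>"
  let ?S = "{x \<in> sphere 0 r. c \<le> u x}"
  show "geodesic_ball r (r *\<^sub>R p) ?S"
  proof (cases "?S = {}")
    case True
    have "\<not> geo_dist r x (r *\<^sub>R p) < 0" if "x \<in> sphere 0 r" for x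
      using geo_dist_axis(3)[OF r p, of x] that by simp
    \<comment> \<open>The empty set is the open geodesic ball of radius 0.\<close>
    then have "?S = {x \<in> sphere 0 r. geo_dist r x (r *\<^sub>R p) < 0}"
      using True by blast
    then show ?thesis unfolding geodesic_ball_def by blast
  next
    case False
    have "continuous_on (sphere 0 r) u"
      using cont sub by (rule continuous_on_subset)
    then have "closed (sphere 0 r \<inter> u -` {c..})"
      by (rule continuous_closed_preimage) auto
    then have "compact (sphere 0 r \<inter> (sphere 0 r \<inter> u -` {c..}))"
      by (intro compact_Int_closed compact_sphere)
    moreover have "sphere 0 r \<inter> (sphere 0 r \<inter> u -` {c..}) = ?S" by auto
    ultimately have "compact ?S" by simp
    moreover have "continuous_on ?S (\<lambda>x. x \<bullet> p)"
      by (intro continuous_intros)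
    ultimately obtain x1 where x1: "x1 \<in> ?S" "\<And>x. x \<in> ?S \<Longrightarrow> x1 \<bullet> p \<le> x \<bullet> p"
      using continuous_attains_inf[OF _ False] by blast
    have "?S = {x \<in> sphere 0 r. x1 \<bullet> p \<le> x \<bullet> p}"
      using x1 mono[of _ x1] by fastforce
    then show ?thesis
      using geodesic_ball_cap[OF r p, of x1] x1(1) by simp
  qed
qed

lemma foliated_schwarz_sym_if_ordered_by_reflections:
  fixes u :: "real^'n \<Rightarrow> real"
  assumes \<Omega>: "open \<Omega>" "continuous_on \<Omega> u" and inv: "\<And>e x. reflect e x \<in> \<Omega> \<longleftrightarrow> x \<in> \<Omega>"
    and zero: "\<And>x. x \<notin> \<Omega> \<Longrightarrow> u x = 0"
    and u: "u \<in> borel_measurable borel" "integrable lborel (\<lambda>x. (u x)\<^sup>2)"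
    and ord: "\<And>e. e \<noteq> 0 \<Longrightarrow> (\<forall>x. 0 \<le> x \<bullet> e \<longrightarrow> u (reflect e x) \<le> u x)
      \<or> (\<forall>x. 0 \<le> x \<bullet> e \<longrightarrow> u x \<le> u (reflect e x))"
  shows "\<exists>p \<in> sphere 0 1. foliated_schwarz_sym \<Omega> p u"
proof -
  define m where "m = weighted_moment u"
  have ge: "u (reflect e x) \<le> u x" if "e \<noteq> 0" "0 \<le> m \<bullet> e" "0 \<le> x \<bullet> e" for e x
  proof (cases "\<forall>x. 0 \<le> x \<bullet> e \<longrightarrow> u (reflect e x) \<le> u x")
    case False
    have eq: "reflect (- e) x = reflect e x" for x
      by (simp add: reflect_def)
    have ord': "u (reflect (- e) y) \<le> u y" if "0 \<le> y \<bullet> (- e)" for y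
      using ord[OF \<open>e \<noteq> 0\<close>] False that
      by (metis eq inner_minus_right inner_reflect_left reflect_reflect)
    have "0 \<le> m \<bullet> (- e)"
      \<comment> \<open>The order favours \<open>- e\<close> here, so the moment has nonnegative
        inner product with \<open>- e\<close> as well as with \<open>e\<close>; it is therefore 0
        and \<open>u\<close> is symmetric.\<close>
      unfolding m_def by (rule weighted_moment_reflect(1)[OF \<Omega> inv zero u ord'])
    then have "m \<bullet> (- e) = 0" using that(2) by simp
    then have "u (reflect (- e) x) = u x"
      using weighted_moment_reflect(2)[OF \<Omega> inv zero u, of "- e"] ord' by (simp add: m_def)
    then show ?thesis by (simp add: eq)
  qed (use that in blast)
  \<comment> \<open>A vanishing moment is orthogonal to every normal, so any unit vector can serve
    as axis.\<close>
  obtain p where p: "norm p = 1" "m = norm m *\<^sub>R p"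
  proof (cases "m = 0")
    case True
    obtain p :: "real^'n" where "norm p = 1" using vector_choose_size[of 1] by auto
    then show ?thesis using that True by simp
  next
    case False
    then show ?thesis using that[of "sgn m"] by (simp add: norm_sgn sgn_div_norm)
  qed
  have "u y \<le> u x" if "norm x = norm y" "y \<bullet> p \<le> x \<bullet> p" for x y
  proof (cases "x = y")
    case False
    have "m \<bullet> (x - y) = norm m * (x \<bullet> p - y \<bullet> p)"
      by (subst p(2)) (simp add: inner_diff_right inner_commute)
    then have "0 \<le> m \<bullet> (x - y)" using that(2) by simp
    \<comment> \<open>This puts \<open>x\<close> on the favoured side of the hyperplane whose
      reflection takes \<open>x\<close> to \<open>y\<close>.\<close>
    moreover have "0 \<le> x \<bullet> (x - y)"
    proof -
      have "x \<bullet> y \<le> norm x * norm y" by (rule norm_cauchy_schwarz)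
      then show ?thesis
        using that(1) by (simp add: inner_diff_right power2_norm_eq_inner[symmetric] power2_eq_square)
    qed
    ultimately show ?thesis
      using ge[of "x - y" x] reflect_swap[OF that(1)] False by simp
  qed simp
  then have "foliated_schwarz_sym \<Omega> p u"
    by (intro foliated_schwarz_symI[OF \<Omega>(2) p(1)])
  then show ?thesis using p(1) by auto
qed

theorem theorem5p1:
  fixes \<Omega> :: "(real^'n) set"
    and k :: "real \<Rightarrow> real"
    and f :: "real \<Rightarrow> real \<Rightarrow> real"
    and s q a1 a2 :: real
    and u :: "real^'n \<Rightarrow> real"
  assumes N2: "CARD('n) \<ge> 2"
    and \<Omega>_open: "open \<Omega>" and \<Omega>_radial: "radial_set \<Omega>"
    and s: "0 < s" "s < 1"
    and k_pos: "\<forall>r>0. k r > 0"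
    and k_decr: "\<forall>r t. 0 < r \<and> r < t \<longrightarrow> k t < k r"
    and k_int: "(\<integral>\<^sup>+ r\<in>{0<..}. ennreal (min 1 (r^2) * k r * r ^ (CARD('n) - 1)) \<partial>lborel) < \<infinity>"
    and k_nonint: "(\<integral>\<^sup>+ r\<in>{0<..}. ennreal (k r * r ^ (CARD('n) - 1)) \<partial>lborel) = \<infinity>"
    and k2: "\<exists>c1 r0. c1 > 0 \<and> r0 > 0 \<and>
               (\<forall>r. 0 < r \<and> r \<le> r0 \<longrightarrow> k r \<ge> c1 * r powr (- real CARD('n) - 2 * s))"
    and F1: "\<forall>K>0. \<exists>L>0. \<forall>r\<ge>0. \<forall>v w. \<bar>v\<bar> \<le> K \<and> \<bar>w\<bar> \<le> K \<longrightarrow>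
               \<bar>f r v - f r w\<bar> \<le> L * \<bar>v - w\<bar>"
    and F2a: "\<forall>r\<ge>0. f r 0 = 0"
    and F2b: "\<exists>\<delta>>0. \<forall>v. v \<noteq> 0 \<and> \<bar>v\<bar> \<le> \<delta> \<longrightarrow> (\<forall>r\<ge>0. f r v / v \<le> 0)"
    and q: "2 \<le> q" "q \<le> 2 * real CARD('n) / (real CARD('n) - 2 * s)"
    and growth: "\<forall>r\<ge>0. \<forall>v. \<bar>f r v\<bar> \<le> a1 * \<bar>v\<bar> + a2 * \<bar>v\<bar> powr (q - 1)"
    and uD: "u \<in> DJ k \<Omega>"
    and u_cont: "continuous_on \<Omega> u"
    and u_bdd: "bounded (range u)"
    and u_min: "(\<forall>v\<in>DJ k \<Omega>. Kfun k f \<Omega> u \<le> Kfun k f \<Omega> v)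
             \<or> (Lq_pow q \<Omega> u = 1 \<and>
                (\<forall>v\<in>DJ k \<Omega>. Lq_pow q \<Omega> v = 1 \<longrightarrow> Kfun k f \<Omega> u \<le> Kfun k f \<Omega> v))"
    and u_decay: "(u \<longlongrightarrow> 0) at_infinity"
  shows "\<exists>p \<in> sphere (0::real^'n) 1. foliated_schwarz_sym \<Omega> p u"
proof -
  interpret decreasing_kernel k
    using k_pos k_decr by unfold_locales auto
  have inv: "reflect e x \<in> \<Omega> \<longleftrightarrow> x \<in> \<Omega>" for e x
    by (rule radial_reflect[OF N2 \<Omega>_radial])
  have [measurable]: "u \<in> borel_measurable borel" and int: "integrable lborel (\<lambda>x. (u x)\<^sup>2)"
    and zero: "\<And>x. x \<notin> \<Omega> \<Longrightarrow> u x = 0"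
    using uD by (auto simp: DJ_def)
  have "Jform k u u \<le> Jform k (polarization e u) (polarization e u)" if e: "e \<noteq> 0" for e
  proof -
    have "polarization e u \<in> DJ k \<Omega>"
      by (rule polarization_DJ[OF e inv uD])
    \<comment> \<open>With the constraint preserved, both kinds of minimizer can be compared with
      the polarization; equality of the potential terms then leaves only the quadratic form.\<close>
    moreover have "Lq_pow q \<Omega> (polarization e u) = Lq_pow q \<Omega> u"
      unfolding Lq_pow_def
      using integral_polarization[of u e \<Omega> "\<lambda>_ t. \<bar>t\<bar> powr q"] inv by simp
    ultimately have "Kfun k f \<Omega> u \<le> Kfun k f \<Omega> (polarization e u)"
      using u_min by auto
    moreover have "(LINT x:\<Omega>|lborel. Fprim f (norm x) (polarization e u x))
        = (LINT x:\<Omega>|lborel. Fprim f (norm x) (u x))"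
      using inv by (intro integral_polarization) simp_all
    ultimately show ?thesis by (simp add: Kfun_def)
  qed
  then show ?thesis
    using minimizer_ordered_by_reflections[OF \<Omega>_open u_cont _ inv uD]
    by (intro foliated_schwarz_sym_if_ordered_by_reflections[OF \<Omega>_open u_cont inv zero _ int])
      simp_all
qed

end
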